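(* The identity $$\tau F\!\left(T_1(a),T_1(b);T_1(c);\tfrac{ab}{c}\,t\right) - x\,F(a,b;c;t) = -F(a,b;c;xt)$$ holds for any values of the variable $t$ and the parameters $a,b,c$ such that all the terms of the identity make sense. In particular, if $|a|=|b|=|c|=1$, then the right-hand side of the identity is overconvergent, that is, the series for the right-hand side converges for $|t|<q^{1-\frac{1}{q-1}}$ ($>1$).
   Context: Let $\mathbb F_q$ be a finite field with $q$ elements and let $K=\mathbb F_q((x))$ be the field of formal Laurent series $z=\sum_{i=n}^\infty \zeta_i x^i$, $n\in\mathbb Z$, $\zeta_i\in\mathbb F_q$, with the non-Archimedean absolute value $|z|=q^{-n}$ if $\zeta_n\neq 0$ (so $|x|=q^{-1}$). Let $\overline{K}_c$ be the completion of an algebraic closure of $K$; the extension of the absolute value to $\overline{K}_c$ is also denoted $|\cdot|$. The variable $t$ and the parameters $a,b,c$ lie in $\overline{K}_c$. For $n\ge 0$ put $[n]=x^{q^n}-x$ (so $[0]=0$), and $[\infty]=-x$. The Carlitz factorial is $D_0=1$ and $D_n=[n][n-1]^q\cdots[1]^{q^{n-1}}$ for $n\ge 1$. For $a\in\overline{K}_c$ define $\langle a\rangle_0=1$ and $$\langle a\rangle_n=([0]-a)^{q^n}([1]-a)^{q^{n-1}}\cdots([n-1]-a)^q,\quad n\ge 1.$$ For $a,b,c\in\overline{K}_c$ with $c\notin\{[0],[1],\ldots,[\infty]\}$, the hypergeometric function is $$F(a,b;c;t)=\sum_{n=0}^\infty\frac{\langle a\rangle_n\langle b\rangle_n}{\langle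 c\rangle_n D_n}t^{q^n}.$$ Denote $T_1(a)=(a-[1])^{1/q}$ for $a\in\overline{K}_c$ (the unique $q$-th root in $\overline{K}_c$), and let $\tau$ be the operator $\tau u=u^q$, so that $\tau F(T_1(a),T_1(b);T_1(c);z)=\left(F(T_1(a),T_1(b);T_1(c);z)\right)^q$. When $|a|=|b|=|c|=1$, the series for $F(a,b;c;t)$ itself has disk of convergence $\{t\in\overline{K}_c: |t|<q^{-\frac1{q-1}}\}$.
   Formalization: The parenthetical claim that q^{1-1/(q-1)} > 1 is proved only for q > 2, because for q = 2 this radius equals exactly 1; the identity and the convergence for |t| < q^{1-1/(q-1)} are proved for all q. *)

theory Defs
  imports
    "HOL-Analysis.Analysis"
    "HOL-Computational_Algebra.Formal_Laurent_Series"
    "HOL-Algebra.Algebraic_Closure_Type"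
begin

definition laurent_abs :: "'f::{finite,field} fls \<Rightarrow> real" where
  "laurent_abs f = (if f = 0 then 0 else real CARD('f) powi (- fls_subdegree f))"

(* The library's norm is confined to real normed spaces, which have characteristic 0. Here
   the absolute value is the distance from 0; the metric is required to be induced by it. *)
definition absval :: "'c::{zero,metric_space} \<Rightarrow> real" where
  "absval z = dist z 0"

(* The type 'c, with the embedding emb, is a completion of the algebraic closure of the
   local field F_q((x)), where F_q is 'f: a complete field with a multiplicative ultrametric
   absolute value that extends laurent_abs, in which the algebraic closure is dense.
   These properties determine 'c up to isometric isomorphism. *)
locale completed_algebraic_closure =
  fixes emb :: "'f::{finite,field} fls alg_closure \<Rightarrow> 'c::{field,complete_space}"
  assumes emb_one: "emb 1 = 1"
    and emb_add: "emb (u + v) = emb u + emb v"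
    and emb_mult: "emb (u * v) = emb u * emb v"
    and dist_absval: "dist y z = absval (y - z :: 'c)"
    and absval_mult: "absval (y * z :: 'c) = absval y * absval z"
    and absval_ultrametric: "absval (y + z :: 'c) \<le> max (absval y) (absval z)"
    and absval_extends: "absval (emb (to_ac f)) = laurent_abs f"
    and emb_dense: "closure (range emb) = UNIV"

(* In what follows q is the cardinality of F_q, and x is the image of the variable of
   F_q((x)). *)

definition bracket :: "nat \<Rightarrow> 'c::field \<Rightarrow> nat \<Rightarrow> 'c" where
  "bracket q x n = x ^ (q ^ n) - x"

definition bracket_inf :: "'c::field \<Rightarrow> 'c" where
  "bracket_inf x = - x"

definition carlitz_factorial :: "nat \<Rightarrow> 'c::field \<Rightarrow> nat \<Rightarrow> 'c" where
  "carlitz_factorial q x n = (\<Prod>i=1..n. bracket q x i ^ (q ^ (n - i)))"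

definition carlitz_poch :: "nat \<Rightarrow> 'c::field \<Rightarrow> 'c \<Rightarrow> nat \<Rightarrow> 'c" where
  "carlitz_poch q x a n = (\<Prod>i<n. (bracket q x i - a) ^ (q ^ (n - i)))"

definition hypergeom_term ::
    "nat \<Rightarrow> 'c::field \<Rightarrow> 'c \<Rightarrow> 'c \<Rightarrow> 'c \<Rightarrow> 'c \<Rightarrow> nat \<Rightarrow> 'c" where
  "hypergeom_term q x a b c t n =
     carlitz_poch q x a n * carlitz_poch q x b n /
       (carlitz_poch q x c n * carlitz_factorial q x n) * t ^ (q ^ n)"

definition hypergeom ::
    "nat \<Rightarrow> 'c::{field,topological_space} \<Rightarrow> 'c \<Rightarrow> 'c \<Rightarrow> 'c \<Rightarrow> 'c \<Rightarrow> 'c" where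
  "hypergeom q x a b c t = (\<Sum>n. hypergeom_term q x a b c t n)"

(* F(a,b;c;t) makes sense: c is an admissible parameter and the series converges at t. *)
definition hypergeom_defined ::
    "nat \<Rightarrow> 'c::{field,topological_space} \<Rightarrow> 'c \<Rightarrow> 'c \<Rightarrow> 'c \<Rightarrow> 'c \<Rightarrow> bool" where
  "hypergeom_defined q x a b c t \<longleftrightarrow>
     c \<notin> insert (bracket_inf x) (range (bracket q x)) \<and>
     summable (hypergeom_term q x a b c t)"

(* (a - [1])^(1/q): in the completed algebraic closure, which is perfect of characteristic
   dividing q, there is exactly one q-th root. *)
definition T1 :: "nat \<Rightarrow> 'c::field \<Rightarrow> 'c \<Rightarrow> 'c" where
  "T1 q x a = (THE r. r ^ q = a - bracket q x 1)"

definition tau :: "nat \<Rightarrow> 'c::field \<Rightarrow> 'c" where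
  "tau q u = u ^ q"

end

theory Submission
  imports Defs
begin

text \<open>
  The identity already holds between partial sums, and it comes from one relation between the
  coefficients. Since raising to the power \<open>q\<close> is additive and \<open>[i]\<^sup>q = [i+1] - [1]\<close>, the choice
  \<open>T\<^sub>1(a)\<^sup>q = a - [1]\<close> makes \<open>([i] - T\<^sub>1(a))\<^sup>q = [i+1] - a\<close>: the operator \<open>\<tau>\<close> shifts every factor
  of the symbol of \<open>T\<^sub>1(a)\<close> to the next factor of the symbol of \<open>a\<close>
  (\<open>carlitz_poch_Suc_eq_T1\<close>), while \<open>D\<^sub>n\<^sup>q\<close> is \<open>D\<^bsub>n+1\<^esub>\<close> without its factor \<open>[n+1]\<close>
  (\<open>carlitz_factorial_Suc\<close>). The factor \<open>[0] - a = -a\<close> that the shift misses is supplied by the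
  argument \<open>(ab/c)t\<close>. So the \<open>q\<close>-th power of the \<open>n\<close>-th term on the left is
  \<open>-[n+1]\<close> times the \<open>(n+1)\<close>-st term of \<open>F(a,b;c;t)\<close> (\<open>hypergeom_term_T1_power\<close>).
  Subtracting \<open>x F(a,b;c;t)\<close> turns the weights \<open>-[n]\<close> into \<open>-([n] + x) = -x^(q^n)\<close>, and these
  weights are exactly the effect of replacing \<open>t\<close> by \<open>xt\<close>. The limit is then taken with the
  continuity of the Frobenius map.

  Additivity of the power \<open>q\<close> amounts to the vanishing of the inner binomial coefficients in
  \<open>F\<^sub>q\<close>, proved by counting the roots of a polynomial. The existence of the \<open>q\<close>-th roots
  behind \<open>T\<^sub>1\<close> passes from the algebraic closure to its completion because the Frobenius map raises
  distances to the power \<open>q\<close>, so that roots of a Cauchy sequence form a Cauchy sequence.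

  For unit parameters all symbols are units, since \<open>|[i]| < 1\<close>, and the size of the terms is
  governed by \<open>|D\<^sub>n| = q^(-(q^n - 1)/(q - 1))\<close>. Hence the series converges for
  \<open>|s| < q^(-1/(q-1))\<close>, and with \<open>s = xt\<close> the factor \<open>|x| = 1/q\<close> enlarges the disk.
\<close>

section \<open>The Frobenius power over a finite field\<close>

text \<open>
  Multiplication by a nonzero \<open>z\<close> permutes the units, so the product of all units is
  unchanged when it is multiplied by the power of \<open>z\<close> whose exponent is their number.
\<close>

lemma finite_field_pow_card:
  fixes z :: "'f::{finite,field}"
  shows "z ^ CARD('f) = z"
proof (cases "z = 0")
  case False
  let ?U = "UNIV - {0 :: 'f}"
  have bij: "bij_betw ((*) z) ?U ?U"
    using False by (intro bij_betwI[where g = "\<lambda>u. u / z"]) auto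
  have "(\<Prod>u\<in>?U. u) = (\<Prod>u\<in>?U. z * u)"
    using prod.reindex_bij_betw[OF bij, of "\<lambda>u. u"] by simp
  also have "\<dots> = z ^ card ?U * (\<Prod>u\<in>?U. u)"
    by (simp add: prod.distrib)
  finally have "z ^ card ?U = 1"
    by simp
  moreover have "CARD('f) = Suc (card ?U)"
    by (metis UNIV_I card.remove finite)
  ultimately show ?thesis
    by (metis power_Suc mult_1_right)
qed simp

text \<open>
  With \<open>q\<close> the number of elements, \<open>(z+1)\<^sup>q - z\<^sup>q - 1\<close> vanishes at every one of the \<open>q\<close> elements
  \<open>z\<close>, but as a polynomial it has degree below \<open>q\<close>, so all its coefficients are zero. As an
  identity between multiples of \<open>1\<close> it passes to every extension ring, where it makes
  \<open>z \<mapsto> z\<^sup>q\<close> additive.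
\<close>

lemma of_nat_binomial_card_eq_0:
  assumes "0 < k" "k < CARD('f::{finite,field})"
  shows "of_nat (CARD('f) choose k) = (0 :: 'f)"
proof -
  let ?q = "CARD('f)"
  define p :: "'f poly" where "p = (\<Sum>k=1..<?q. Polynomial.monom (of_nat (?q choose k)) k)"
  have zero: "poly p z = 0" for z :: 'f
  proof -
    have split: "{..?q} = insert 0 (insert ?q {1..<?q})"
      by auto
    have "z + 1 = (z + 1) ^ ?q"
      by (simp add: finite_field_pow_card)
    also have "\<dots> = (\<Sum>k\<le>?q. of_nat (?q choose k) * z ^ k)"
      by (simp add: binomial_ring)
    also have "\<dots> = 1 + z ^ ?q + poly p z"
      unfolding split p_def by (simp add: poly_sum poly_monom)
    finally show ?thesis
      by (simp add: finite_field_pow_card)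
  qed
  have "Polynomial.degree p \<le> ?q - 1"
    unfolding p_def by (intro degree_sum_le) (auto intro: order_trans[OF degree_monom_le])
  hence deg: "Polynomial.degree p < ?q"
    using assms by linarith
  have "p = 0"
  proof (rule ccontr)
    assume "p \<noteq> 0"
    hence "card {z. poly p z = 0} \<le> Polynomial.degree p"
      by (rule card_poly_roots_bound)
    with deg zero show False
      by simp
  qed
  hence "Polynomial.coeff p k = 0"
    by simp
  thus ?thesis
    using assms by (simp add: p_def coeff_sum)
qed

lemma card_finite_field_ge_2: "2 \<le> CARD('f::{finite,field})"
proof -
  have "card {0, 1 :: 'f} \<le> CARD('f)"
    by (rule card_mono) auto
  thus ?thesis
    by simp
qed

section \<open>Ultrametric calculus\<close>

text \<open>
  The topology on the completed closure comes from its absolute value alone, and its type carries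
  neither a norm nor the class of a topological group. Limits of differences and multiples, and
  convergence of series, are therefore derived from the ultrametric inequality.
\<close>

locale carlitz_setting = completed_algebraic_closure emb
  for emb :: "'f::{finite,field} fls alg_closure \<Rightarrow> 'c::{field,complete_space}" +
  fixes q :: nat and x :: 'c
  assumes q_eq: "q = CARD('f)"
    and x_eq: "x = emb (to_ac fls_X)"
begin

lemma emb_0 [simp]: "emb 0 = 0"
  using emb_add[of 0 0] by (simp only: add_0 add_cancel_right_right)

lemma emb_of_nat: "emb (of_nat n) = of_nat n"
  by (induction n) (simp_all add: emb_one emb_add)

lemma emb_power: "emb (u ^ n) = emb u ^ n"
  by (induction n) (simp_all add: emb_one emb_mult)

lemma absval_nonneg [simp]: "0 \<le> absval (z :: 'c)"
  by (simp add: absval_def)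

lemma absval_eq_0_iff [simp]: "absval (z :: 'c) = 0 \<longleftrightarrow> z = 0"
  by (simp add: absval_def)

lemma absval_0 [simp]: "absval (0 :: 'c) = 0"
  by simp

lemma absval_1 [simp]: "absval (1 :: 'c) = 1"
  using absval_mult[of 1 1] absval_eq_0_iff[of 1] by auto

lemma absval_power: "absval (z ^ n :: 'c) = absval z ^ n"
  by (induction n) (simp_all add: absval_mult)

lemma absval_prod: "absval (\<Prod>i\<in>A. f i :: 'c) = (\<Prod>i\<in>A. absval (f i))"
  by (induction A rule: infinite_finite_induct) (simp_all add: absval_mult)

lemma absval_divide: "absval (y / z :: 'c) = absval y / absval z"
proof (cases "z = 0")
  case False
  then show ?thesis
    using absval_mult[of "y / z" z] by (simp add: field_simps)
qed simp

lemma absval_minus_commute: "absval (y - z :: 'c) = absval (z - y)"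
  by (metis dist_absval dist_commute)

lemma absval_minus [simp]: "absval (- z :: 'c) = absval z"
  using absval_minus_commute[of 0 z] by simp

lemma absval_ultrametric_diff: "absval (y - z :: 'c) \<le> max (absval y) (absval z)"
  using absval_ultrametric[of y "- z"] by simp

text \<open>
  The larger term dominates: otherwise \<open>z = y - (y - z)\<close> would be smaller than itself.
\<close>

lemma absval_diff_eq_right:
  fixes y z :: 'c
  assumes "absval y < absval z"
  shows "absval (y - z) = absval z"
proof -
  have "absval z \<le> max (absval y) (absval (y - z))"
    using absval_ultrametric_diff[of y "y - z"] by simp
  with assms absval_ultrametric_diff[of y z] show ?thesis
    by linarith
qed

lemma tendsto_iff_absval:
  fixes f :: "nat \<Rightarrow> 'c"
  shows "f \<longlonglongrightarrow> l \<longleftrightarrow> (\<lambda>n. absval (f n - l)) \<longlonglongrightarrow> 0"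
  by (subst tendsto_dist_iff) (simp add: dist_absval)

lemma tendsto_diff_absval:
  fixes f g :: "nat \<Rightarrow> 'c"
  assumes "f \<longlonglongrightarrow> l" "g \<longlonglongrightarrow> m"
  shows "(\<lambda>n. f n - g n) \<longlonglongrightarrow> l - m"
proof -
  have bound: "absval ((f n - g n) - (l - m)) \<le> max (absval (f n - l)) (absval (g n - m))" for n
    using absval_ultrametric_diff[of "f n - l" "g n - m"] by (simp add: algebra_simps)
  have "(\<lambda>n. max (absval (f n - l)) (absval (g n - m))) \<longlonglongrightarrow> max 0 0"
    using assms unfolding tendsto_iff_absval by (rule tendsto_max)
  hence lim: "(\<lambda>n. max (absval (f n - l)) (absval (g n - m))) \<longlonglongrightarrow> 0"
    by simp
  show ?thesis
    unfolding tendsto_iff_absval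
    by (rule tendsto_sandwich[OF _ _ tendsto_const lim]) (use bound in auto)
qed

lemma tendsto_mult_left_absval:
  fixes f :: "nat \<Rightarrow> 'c"
  assumes "f \<longlonglongrightarrow> l"
  shows "(\<lambda>n. y * f n) \<longlonglongrightarrow> y * l"
proof -
  have "(\<lambda>n. absval y * absval (f n - l)) \<longlonglongrightarrow> absval y * 0"
    using assms unfolding tendsto_iff_absval by (intro tendsto_intros)
  thus ?thesis
    unfolding tendsto_iff_absval by (simp add: absval_mult flip: right_diff_distrib)
qed

lemma absval_sum_le:
  fixes f :: "nat \<Rightarrow> 'c"
  assumes "\<And>i. i \<in> A \<Longrightarrow> absval (f i) \<le> e" "0 \<le> e"
  shows "absval (\<Sum>i\<in>A. f i) \<le> e"
  using assms(1)
proof (induction A rule: infinite_finite_induct)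
  case (insert i A)
  then have "absval (f i) \<le> e" "absval (\<Sum>i\<in>A. f i) \<le> e"
    by auto
  with insert.hyps absval_ultrametric[of "f i" "\<Sum>i\<in>A. f i"] show ?case
    by simp
qed (use assms(2) in auto)

text \<open>
  In a complete ultrametric field the distance of two partial sums is at most the largest term
  between them, so null sequences are summable.
\<close>

lemma summable_if_terms_tendsto_0:
  fixes f :: "nat \<Rightarrow> 'c"
  assumes "(\<lambda>n. absval (f n)) \<longlonglongrightarrow> 0"
  shows "summable f"
proof -
  have "Cauchy (\<lambda>n. \<Sum>i<n. f i)"
    unfolding Cauchy_altdef
  proof (intro allI impI)
    fix e :: real
    assume e: "e > 0"
    then obtain M where M: "\<And>n. n \<ge> M \<Longrightarrow> absval (f n) < e / 2"
      using order_tendstoD(2)[OF assms, of "e / 2"] unfolding eventually_sequentially by auto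
    show "\<exists>M. \<forall>m\<ge>M. \<forall>n>m. dist (\<Sum>i<m. f i) (\<Sum>i<n. f i) < e"
    proof (intro exI[of _ M] allI impI)
      fix m n
      assume mn: "M \<le> m" "m < n"
      have "(\<Sum>i<n. f i) - (\<Sum>i<m. f i) = (\<Sum>i=m..<n. f i)"
        using mn sum_diff_nat_ivl[of 0 m n f] by (simp add: atLeast0LessThan)
      moreover have "absval (\<Sum>i=m..<n. f i) \<le> e / 2"
        by (rule absval_sum_le) (use mn M e in \<open>auto intro!: less_imp_le\<close>)
      moreover have "dist (\<Sum>i<m. f i) (\<Sum>i<n. f i) = absval ((\<Sum>i<n. f i) - (\<Sum>i<m. f i))"
        by (metis dist_absval dist_commute)
      ultimately show "dist (\<Sum>i<m. f i) (\<Sum>i<n. f i) < e"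
        using e by simp
    qed
  qed
  hence "convergent (\<lambda>n. \<Sum>i<n. f i)"
    by (rule Cauchy_convergent)
  thus ?thesis
    by (simp add: summable_iff_convergent)
qed

section \<open>The Frobenius of the completed closure\<close>

lemma q_ge_2: "2 \<le> q"
  unfolding q_eq by (rule card_finite_field_ge_2)

lemma of_nat_binomial_eq_0:
  assumes "0 < k" "k < q"
  shows "of_nat (q choose k) = (0 :: 'c)"
proof -
  have "(of_nat (q choose k) :: 'f fls) = fls_const (of_nat (q choose k))"
    by (simp add: fls_of_nat)
  also have "\<dots> = 0"
    using assms by (simp add: q_eq of_nat_binomial_card_eq_0)
  finally have "emb (to_ac (of_nat (q choose k))) = 0"
    by simp
  thus ?thesis
    by (simp add: emb_of_nat)
qed

lemma frobenius_add: "(y + z :: 'c) ^ q = y ^ q + z ^ q"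
proof -
  have split: "{..q} = insert 0 (insert q {1..<q})"
    using q_ge_2 by auto
  have "(y + z) ^ q = (\<Sum>k\<le>q. of_nat (q choose k) * y ^ k * z ^ (q - k))"
    by (rule binomial_ring)
  also have "\<dots> = y ^ q + z ^ q"
    unfolding split using q_ge_2 by (simp add: of_nat_binomial_eq_0)
  finally show ?thesis .
qed

lemma frobenius_diff: "(y - z :: 'c) ^ q = y ^ q - z ^ q"
  using frobenius_add[of "y - z" z] by simp

lemma frobenius_sum: "(\<Sum>i\<in>A. f i :: 'c) ^ q = (\<Sum>i\<in>A. f i ^ q)"
  by (induction A rule: infinite_finite_induct) (use q_ge_2 in \<open>simp_all add: frobenius_add\<close>)

lemma power_q_Suc: "z ^ q ^ Suc n = (z ^ q ^ n) ^ q" for z :: 'c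
  by (metis power_Suc2 power_mult)

lemma uminus_power_q_power: "(- z :: 'c) ^ q ^ n = - (z ^ q ^ n)"
proof (induction n)
  case (Suc n)
  then show ?case
    using frobenius_diff[of 0 "z ^ q ^ n"] q_ge_2
    by (simp add: power_q_Suc del: power_Suc)
qed simp

text \<open>
  The Frobenius map transforms distances by the strictly increasing function \<open>d \<mapsto> d\<^sup>q\<close>. This gives
  its continuity and lets Cauchy sequences be lifted along it.
\<close>

lemma absval_frobenius_diff: "absval (y ^ q - z ^ q :: 'c) = absval (y - z) ^ q"
  by (simp add: absval_power flip: frobenius_diff)

lemma frobenius_inj: "y ^ q = z ^ q \<longleftrightarrow> y = (z :: 'c)"
  using frobenius_diff[of y z] q_ge_2 by auto

lemma tendsto_frobenius:
  fixes f :: "nat \<Rightarrow> 'c"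
  assumes "f \<longlonglongrightarrow> l"
  shows "(\<lambda>n. f n ^ q) \<longlonglongrightarrow> l ^ q"
  using assms q_ge_2 unfolding tendsto_iff_absval by (simp add: absval_frobenius_diff)

text \<open>
  Approximate \<open>z\<close> by elements \<open>w\<^sub>n\<close> of the algebraic closure and choose roots \<open>s\<^sub>n\<close> there. Distances
  between the \<open>s\<^sub>n\<close> are the \<open>q\<close>-th roots of those between the \<open>w\<^sub>n\<close>, so the \<open>s\<^sub>n\<close> converge,
  and the limit is a root of \<open>z\<close>.
\<close>

lemma frobenius_surj: "\<exists>r :: 'c. r ^ q = z"
proof -
  have "z \<in> closure (range emb)"
    by (simp add: emb_dense)
  then obtain w where w: "\<And>n. w n \<in> range emb" "w \<longlonglongrightarrow> z"
    unfolding closure_sequential by blast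
  have "\<exists>s. s ^ q = w n" for n
  proof -
    from w(1)[of n] obtain u where u: "w n = emb u"
      by auto
    obtain v where "v ^ q = u"
      using nth_root_exists[of q u] q_ge_2 by auto
    with u show ?thesis
      by (metis emb_power)
  qed
  then obtain s where s: "\<And>n. s n ^ q = w n"
    by metis
  have "Cauchy s"
    unfolding Cauchy_def
  proof (intro allI impI)
    fix e :: real
    assume e: "e > 0"
    with LIMSEQ_imp_Cauchy[OF w(2)]
    obtain M where M: "\<And>m n. m \<ge> M \<Longrightarrow> n \<ge> M \<Longrightarrow> dist (w m) (w n) < e ^ q"
      unfolding Cauchy_def by (metis zero_less_power)
    have "dist (s m) (s n) < e" if "m \<ge> M" "n \<ge> M" for m n
    proof -
      have "dist (s m) (s n) ^ q < e ^ q"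
        using M[OF that] by (simp add: dist_absval absval_frobenius_diff flip: s)
      thus ?thesis
        using e by (simp add: power_less_imp_less_base)
    qed
    thus "\<exists>M. \<forall>m\<ge>M. \<forall>n\<ge>M. dist (s m) (s n) < e"
      by blast
  qed
  then obtain r where "s \<longlonglongrightarrow> r"
    using Cauchy_convergent convergent_def by blast
  hence "w \<longlonglongrightarrow> r ^ q"
    using tendsto_frobenius[of s r] by (simp add: s)
  with w(2) show ?thesis
    using LIMSEQ_unique by blast
qed

lemma T1_power: "T1 q y a ^ q = a - bracket q y 1" for y a :: 'c
  unfolding T1_def using frobenius_surj frobenius_inj by (rule_tac theI') metis

section \<open>Carlitz products and the contiguity of the terms\<close>

lemma bracket_power: "bracket q y i ^ q = bracket q y (Suc i) - bracket q y 1" for y :: 'c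
  by (simp add: bracket_def frobenius_diff power_q_Suc del: power_Suc)

text \<open>
  The factor with index \<open>0\<close> on the left is \<open>(-a)^(q^(n+1)) = -a^(q^(n+1))\<close>, where the sign survives
  because the Frobenius map is additive. The factors with index \<open>i + 1\<close> are the \<open>q\<close>-th powers of
  those for \<open>T\<^sub>1(a)\<close>.
\<close>

lemma carlitz_poch_Suc_eq_T1:
  fixes y a :: 'c
  shows "carlitz_poch q y a (Suc n) = - (a ^ q ^ Suc n) * carlitz_poch q y (T1 q y a) n ^ q"
proof -
  have "(bracket q y (Suc i) - a) ^ q ^ (n - i) = ((bracket q y i - T1 q y a) ^ q ^ (n - i)) ^ q"
    for i
  proof -
    have "(bracket q y i - T1 q y a) ^ q = bracket q y (Suc i) - a"
      by (simp add: frobenius_diff T1_power bracket_power)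
    thus ?thesis
      by (metis power_mult mult.commute)
  qed
  moreover have "(bracket q y 0 - a) ^ q ^ Suc n = - (a ^ q ^ Suc n)"
    using uminus_power_q_power[of a "Suc n"] by (simp add: bracket_def)
  ultimately show ?thesis
    unfolding carlitz_poch_def 
    by (simp add: prod.lessThan_Suc_shift prod_power_distrib del: power_Suc prod.lessThan_Suc)
qed

lemma carlitz_factorial_Suc:
  fixes y :: 'c
  shows "carlitz_factorial q y (Suc n) = bracket q y (Suc n) * carlitz_factorial q y n ^ q"
proof -
  have "bracket q y i ^ q ^ (Suc n - i) = (bracket q y i ^ q ^ (n - i)) ^ q" if "i \<in> {1..n}" for i
    using that by (simp add: Suc_diff_le power_q_Suc del: power_Suc)
  hence "(\<Prod>i=1..n. bracket q y i ^ q ^ (Suc n - i)) = carlitz_factorial q y n ^ q"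
    unfolding carlitz_factorial_def prod_power_distrib by (intro prod.cong) auto
  thus ?thesis
    by (simp add: carlitz_factorial_def mult.commute)
qed

text \<open>
  Expressing the symbols at \<open>n + 1\<close> through those at \<open>n\<close>, the powers of \<open>a\<close>, \<open>b\<close> and \<open>c\<close> combine
  with the argument \<open>(ab/c)t\<close>, and three minus signs leave one. The bracket compensates the factor
  by which \<open>D\<^bsub>n+1\<^esub>\<close> exceeds \<open>D\<^sub>n\<^sup>q\<close>.
\<close>

lemma hypergeom_term_T1_power:
  fixes y a b c t :: 'c
  assumes "bracket q y (Suc n) \<noteq> 0"
  shows "hypergeom_term q y (T1 q y a) (T1 q y b) (T1 q y c) (a * b / c * t) n ^ q
       = - (bracket q y (Suc n) * hypergeom_term q y a b c t (Suc n))"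
proof -
  define A where "A = carlitz_poch q y (T1 q y a) n ^ q"
  define B where "B = carlitz_poch q y (T1 q y b) n ^ q"
  define C where "C = carlitz_poch q y (T1 q y c) n ^ q"
  define D where "D = carlitz_factorial q y n ^ q"
  define m where "m = q ^ Suc n"
  have "hypergeom_term q y (T1 q y a) (T1 q y b) (T1 q y c) (a * b / c * t) n ^ q
      = A * B / (C * D) * (a * b / c * t) ^ m"
    by (simp add: hypergeom_term_def A_def B_def C_def D_def m_def power_mult_distrib
        power_divide power_q_Suc del: power_Suc)
  also have "\<dots> = - (bracket q y (Suc n) *
      ((- (a ^ m) * A) * (- (b ^ m) * B) / ((- (c ^ m) * C) * (bracket q y (Suc n) * D)) * t ^ m))"
    using assms by (simp add: power_mult_distrib power_divide mult_ac)
  also have "\<dots> = - (bracket q y (Suc n) * hypergeom_term q y a b c t (Suc n))"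
    unfolding hypergeom_term_def carlitz_poch_Suc_eq_T1 carlitz_factorial_Suc
      A_def B_def C_def D_def m_def ..
  finally show ?thesis .
qed

lemma hypergeom_term_mult_arg:
  fixes y a b c t :: 'c
  shows "hypergeom_term q y a b c (y * t) n
       = (bracket q y n + y) * hypergeom_term q y a b c t n"
  by (simp add: hypergeom_term_def bracket_def power_mult_distrib)

text \<open>
  The sum on the left has one term fewer because its terms match those of index \<open>1\<close> to \<open>N\<close> on the
  right; index \<open>0\<close> costs nothing since \<open>[0] = 0\<close>.
\<close>

lemma hypergeom_partial_sums:
  fixes y a b c t :: 'c
  assumes "\<And>n. bracket q y (Suc n) \<noteq> 0"
  shows "(\<Sum>n<N. hypergeom_term q y (T1 q y a) (T1 q y b) (T1 q y c) (a * b / c * t) n) ^ q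
         = y * (\<Sum>n<Suc N. hypergeom_term q y a b c t n)
           - (\<Sum>n<Suc N. hypergeom_term q y a b c (y * t) n)"
proof -
  have "(\<Sum>n<N. hypergeom_term q y (T1 q y a) (T1 q y b) (T1 q y c) (a * b / c * t) n) ^ q
      = - (\<Sum>n<N. bracket q y (Suc n) * hypergeom_term q y a b c t (Suc n))"
    by (simp only: frobenius_sum hypergeom_term_T1_power[OF assms] sum_negf)
  also have "\<dots> = - (\<Sum>n<Suc N. bracket q y n * hypergeom_term q y a b c t n)"
    by (subst sum.lessThan_Suc_shift) (simp add: bracket_def)
  also have "\<dots> = y * (\<Sum>n<Suc N. hypergeom_term q y a b c t n)
           - (\<Sum>n<Suc N. hypergeom_term q y a b c (y * t) n)"
    by (simp only: hypergeom_term_mult_arg distrib_right sum.distrib sum_distrib_left)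
       (simp add: algebra_simps)
  finally show ?thesis .
qed

theorem hypergeom_contiguity:
  fixes y a b c t :: 'c
  assumes "\<And>n. bracket q y (Suc n) \<noteq> 0"
    and "summable (hypergeom_term q y (T1 q y a) (T1 q y b) (T1 q y c) (a * b / c * t))"
    and "summable (hypergeom_term q y a b c t)"
    and "summable (hypergeom_term q y a b c (y * t))"
  shows "hypergeom q y (T1 q y a) (T1 q y b) (T1 q y c) (a * b / c * t) ^ q
         = y * hypergeom q y a b c t - hypergeom q y a b c (y * t)"
proof -
  let ?S = "\<lambda>N. \<Sum>n<N. hypergeom_term q y (T1 q y a) (T1 q y b) (T1 q y c) (a * b / c * t) n"
  have "?S \<longlonglongrightarrow> hypergeom q y (T1 q y a) (T1 q y b) (T1 q y c) (a * b / c * t)"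
    using summable_sums[OF assms(2)] unfolding sums_def hypergeom_def .
  hence "(\<lambda>N. ?S N ^ q)
      \<longlonglongrightarrow> hypergeom q y (T1 q y a) (T1 q y b) (T1 q y c) (a * b / c * t) ^ q"
    by (rule tendsto_frobenius)
  moreover have "(\<lambda>N. ?S N ^ q) \<longlonglongrightarrow> y * hypergeom q y a b c t - hypergeom q y a b c (y * t)"
  proof -
    have lim: "(\<lambda>N. \<Sum>n<Suc N. hypergeom_term q y a b c s n) \<longlonglongrightarrow> hypergeom q y a b c s"
      if "summable (hypergeom_term q y a b c s)" for s
      using LIMSEQ_Suc[OF summable_sums[OF that, unfolded sums_def]] unfolding hypergeom_def .
    show ?thesis
      unfolding hypergeom_partial_sums[OF assms(1)]
      by (rule tendsto_diff_absval[OF tendsto_mult_left_absval[OF lim[OF assms(3)]] lim[OF assms(4)]])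
  qed
  ultimately show ?thesis
    by (rule LIMSEQ_unique)
qed

section \<open>Absolute values of the coefficients and overconvergence\<close>

lemma absval_X: "absval x = 1 / real q"
  using absval_extends[of fls_X] by (simp add: x_eq q_eq laurent_abs_def power_int_minus divide_simps)

lemma absval_X_power_less: "n > 0 \<Longrightarrow> absval (x ^ q ^ n) < absval x"
proof -
  assume "n > 0"
  hence "1 < q ^ n"
    using q_ge_2 by (intro one_less_power) auto
  hence "(1 / real q) ^ (q ^ n) < (1 / real q) ^ 1"
    using q_ge_2 by (intro power_strict_decreasing) auto
  thus ?thesis
    by (simp add: absval_power absval_X)
qed

lemma absval_bracket:
  assumes "n > 0"
  shows "absval (bracket q x n) = 1 / real q"
  unfolding bracket_def using absval_diff_eq_right[OF absval_X_power_less[OF assms]]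
  by (simp add: absval_X)

lemma bracket_nonzero: "bracket q x (Suc n) \<noteq> 0"
proof
  assume "bracket q x (Suc n) = 0"
  with absval_bracket[of "Suc n"] show False
    using q_ge_2 by simp
qed

lemma absval_bracket_less_1: "absval (bracket q x n) < 1"
  using q_ge_2 absval_bracket[of n] by (cases "n = 0") (auto simp: bracket_def)

lemma absval_carlitz_poch_unit:
  assumes "absval a = 1"
  shows "absval (carlitz_poch q x a n) = 1"
proof -
  have "absval (bracket q x i - a) = 1" for i
    using absval_diff_eq_right[of "bracket q x i" a] absval_bracket_less_1[of i] assms by simp
  thus ?thesis
    by (simp add: carlitz_poch_def absval_prod absval_power)
qed

text \<open>
  Each bracket in \<open>D\<^sub>n\<close> has absolute value \<open>1/q\<close>, and the exponents \<open>1, q, \<dots>, q^(n-1)\<close> add up to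
  \<open>(q^n - 1)/(q - 1)\<close>.
\<close>

lemma absval_carlitz_factorial:
  "absval (carlitz_factorial q x n) = real q powr (- ((real q ^ n - 1) / (real q - 1)))"
proof (induction n)
  case 0
  then show ?case
    using q_ge_2 by (simp add: carlitz_factorial_def)
next
  case (Suc n)
  have "absval (carlitz_factorial q x (Suc n))
      = real q powr (- 1) * (real q powr (- ((real q ^ n - 1) / (real q - 1)))) ^ q"
    using q_ge_2 by (simp add: carlitz_factorial_Suc absval_mult absval_power absval_bracket Suc
        powr_minus divide_simps)
  also have "\<dots> = real q powr (- 1 + real q * (- ((real q ^ n - 1) / (real q - 1))))"
    unfolding powr_add using q_ge_2 by (simp add: powr_power mult.commute)
  also have "- 1 + real q * (- ((real q ^ n - 1) / (real q - 1)))
      = - ((real q ^ Suc n - 1) / (real q - 1))"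
    using q_ge_2 by (simp add: field_simps)
  finally show ?case .
qed

text \<open>
  Up to a constant, the terms are the powers with exponent \<open>q^n\<close> of a fixed ratio, which is below
  \<open>1\<close> exactly on the disk of radius \<open>q^(-1/(q-1))\<close>.
\<close>

lemma absval_hypergeom_term_unit:
  assumes "absval a = 1" "absval b = 1" "absval c = 1"
  shows "absval (hypergeom_term q x a b c t n)
       = real q powr (- 1 / (real q - 1)) * (real q powr (1 / (real q - 1)) * absval t) ^ q ^ n"
proof -
  have "absval (hypergeom_term q x a b c t n)
      = real q powr ((real q ^ n - 1) / (real q - 1)) * absval t ^ q ^ n"
    by (simp add: hypergeom_term_def absval_mult absval_divide absval_power
        absval_carlitz_poch_unit assms absval_carlitz_factorial powr_minus divide_simps)
  also have "(real q ^ n - 1) / (real q - 1)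
      = - 1 / (real q - 1) + 1 / (real q - 1) * real (q ^ n)"
    by (simp add: diff_divide_distrib)
  also have "real q powr \<dots> = real q powr (- 1 / (real q - 1)) * (real q powr (1 / (real q - 1))) ^ q ^ n"
    by (simp only: powr_add powr_power[symmetric]) (use q_ge_2 in \<open>simp add: powr_power\<close>)
  finally show ?thesis
    by (simp add: power_mult_distrib)
qed

lemma hypergeom_term_unit_summable:
  assumes "absval a = 1" "absval b = 1" "absval c = 1"
    and t: "absval t < real q powr (- 1 / (real q - 1))"
  shows "summable (hypergeom_term q x a b c t)"
proof (rule summable_if_terms_tendsto_0)
  define r where "r = real q powr (1 / (real q - 1)) * absval t"
  have "r < real q powr (1 / (real q - 1)) * real q powr (- 1 / (real q - 1))"
    unfolding r_def using t q_ge_2 by (intro mult_strict_left_mono) auto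
  also have "\<dots> = 1"
    using q_ge_2 by (simp flip: powr_add)
  finally have r: "0 \<le> r" "r < 1"
    by (auto simp: r_def)
  have le: "r ^ q ^ n \<le> r ^ n" for n
    using r q_ge_2 less_exp[of n] power_mono[of 2 q n]
    by (intro power_decreasing) auto
  have "(\<lambda>n. r ^ q ^ n) \<longlonglongrightarrow> 0"
    by (rule tendsto_sandwich[OF _ _ tendsto_const LIMSEQ_realpow_zero[OF r]])
       (use r le in auto)
  hence "(\<lambda>n. real q powr (- 1 / (real q - 1)) * r ^ q ^ n) \<longlonglongrightarrow> 0"
    by (rule tendsto_mult_right_zero)
  thus "(\<lambda>n. absval (hypergeom_term q x a b c t n)) \<longlonglongrightarrow> 0"
    unfolding absval_hypergeom_term_unit[OF assms(1-3)] r_def .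
qed

lemma hypergeom_defined_unit:
  assumes "absval a = 1" "absval b = 1" "absval c = 1"
    and "absval t < real q powr (- 1 / (real q - 1))"
  shows "hypergeom_defined q x a b c t"
proof -
  have "absval (bracket_inf x) < 1"
    using q_ge_2 by (simp add: bracket_inf_def absval_X)
  hence "c \<noteq> bracket_inf x"
    using assms(3) by auto
  moreover have "c \<noteq> bracket q x n" for n
    using absval_bracket_less_1[of n] assms(3) by auto
  ultimately have "c \<notin> insert (bracket_inf x) (range (bracket q x))"
    by auto
  thus ?thesis
    using hypergeom_term_unit_summable[OF assms] by (simp add: hypergeom_defined_def)
qed

lemma absval_X_mult_less:
  assumes "absval t < real q powr (1 - 1 / (real q - 1))"
  shows "absval (x * t) < real q powr (- 1 / (real q - 1))"
proof -
  have "real q powr (1 - 1 / (real q - 1)) = real q * real q powr (- 1 / (real q - 1))"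
    using powr_add[of "real q" 1 "- 1 / (real q - 1)"] by simp
  with assms show ?thesis
    using q_ge_2 by (simp add: absval_mult absval_X divide_less_eq mult.commute)
qed

end

theorem proposition4:
  fixes emb :: "'f::{finite,field} fls alg_closure \<Rightarrow> 'c::{field,complete_space}"
    and q :: nat
    and x :: 'c
  assumes "completed_algebraic_closure emb"
    and "q = CARD('f)"
    and "x = emb (to_ac fls_X)"
  shows
    "(\<forall>a b c t.
        hypergeom_defined q x (T1 q x a) (T1 q x b) (T1 q x c) (a * b / c * t) \<and>
        hypergeom_defined q x a b c t \<and>
        hypergeom_defined q x a b c (x * t) \<longrightarrow>
        tau q (hypergeom q x (T1 q x a) (T1 q x b) (T1 q x c) (a * b / c * t))
            - x * hypergeom q x a b c t
          = - hypergeom q x a b c (x * t))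
     \<and>
     (\<forall>a b c t.
        absval a = 1 \<and> absval b = 1 \<and> absval c = 1 \<and>
        absval t < real q powr (1 - 1 / (real q - 1)) \<longrightarrow>
        hypergeom_defined q x a b c (x * t))
     \<and>
     (q > 2 \<longrightarrow> real q powr (1 - 1 / (real q - 1)) > 1)"
proof -
  interpret C: completed_algebraic_closure emb
    by fact
  interpret C: carlitz_setting emb q x
    by unfold_locales fact+
  have "real q powr (1 - 1 / (real q - 1)) > 1" if "q > 2"
    using that by (intro gr_one_powr) auto
  moreover have "tau q (hypergeom q x (T1 q x a) (T1 q x b) (T1 q x c) (a * b / c * t))
            - x * hypergeom q x a b c t
          = - hypergeom q x a b c (x * t)"
    if "hypergeom_defined q x (T1 q x a) (T1 q x b) (T1 q x c) (a * b / c * t)"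
      "hypergeom_defined q x a b c t" "hypergeom_defined q x a b c (x * t)" for a b c t
    using C.hypergeom_contiguity[OF C.bracket_nonzero, of a b c t] that
    unfolding hypergeom_defined_def tau_def by simp
  moreover have "hypergeom_defined q x a b c (x * t)"
    if "absval a = 1" "absval b = 1" "absval c = 1"
      "absval t < real q powr (1 - 1 / (real q - 1))" for a b c t
    using C.hypergeom_defined_unit[OF that(1-3) C.absval_X_mult_less] that(4) .
  ultimately show ?thesis
    by blast
qed

end
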